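(* Let $a,b,c,k,l,m$ be positive integers with $c\mid ab$ and $k,l\ge m$, let $h=\frac{a^kb^l}{c^m}$ (a positive integer), and let $d_i^{\pm}=a^{2k}b^{2l}\pm i c^m$ for $i=1,2$, where each $d_i^\pm$ under consideration is a square-free positive integer. Let $F_{\Delta_d}=(1,0,-d)$ denote the form $x^2-dy^2$, of discriminant $\Delta_d=4d$. Then: (i) the reduction of $F_{\Delta_{d_1^+}}$ is $\rho^2(F_{\Delta_{d_1^+}})=(1,2hc^m,-c^m)$; (ii) the reduction of $F_{\Delta_{d_2^+}}$ is $\rho^2(F_{\Delta_{d_2^+}})=(1,2hc^m,-2c^m)$; (iii) the reduction of $F_{\Delta_{d_1^-}}$ is $\rho^2(F_{\Delta_{d_1^-}})=(1,2hc^m-2,1-(2h-1)c^m)$; (iv) the reduction of $F_{\Delta_{d_2^-}}$ is $\rho^2(F_{\Delta_{d_2^-}})=(1,2hc^m-2,1-2(h-1)c^m)$.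
   Context: $(A,B,C)$ denotes the binary quadratic form $Ax^2+Bxy+Cy^2$, of discriminant $\Delta=B^2-4AC$. A form with $\Delta>0$ is reduced if $|\sqrt\Delta-2|A||<B<\sqrt\Delta$. For an indefinite form $F$ write $\rho^0(F)=F$ and $\rho^j(F)=(a_j,b_j,c_j)$; the reduction operator is defined by $$\rho^{j+1}(F)=(c_j,\,-b_j+2c_jr_j,\,c_jr_j^2-b_jr_j+a_j),\qquad r_j=\begin{cases}\operatorname{sign}(c_j)\left\lfloor\frac{b_j}{2|c_j|}\right\rfloor,&|c_j|\ge\sqrt\Delta,\\[1mm]\operatorname{sign}(c_j)\left\lfloor\frac{b_j+\sqrt\Delta}{2|c_j|}\right\rfloor,&|c_j|<\sqrt\Delta.\end{cases}$$ The reduction of $F$ is the reduced form reached by iterating $\rho$ on $F$.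
   Formalization: Part (iv) is stated with the extra hypothesis h ≠ 1, since it fails for h = 1: a=c=3, b=k=l=m=1 gives d_2^- = 3, whose second iterate is (1,2,-2), not (1,4,1); h ≠ 1 is automatic if all four d_i^± are square-free. *)

theory Defs
  imports Complex_Main "HOL-Computational_Algebra.Squarefree"
begin

text \<open>The triple \<open>(A, B, C)\<close> stands for the binary quadratic form \<open>A x\<^sup>2 + B x y + C y\<^sup>2\<close>.\<close>
type_synonym bqf = "int \<times> int \<times> int"

fun disc :: "bqf \<Rightarrow> int" where
  "disc (A, B, C) = B\<^sup>2 - 4 * A * C"

fun reduced :: "bqf \<Rightarrow> bool" where
  "reduced (A, B, C) \<longleftrightarrow>
     disc (A, B, C) > 0 \<and>
     \<bar>sqrt (real_of_int (disc (A, B, C))) - 2 * \<bar>real_of_int A\<bar>\<bar> < real_of_int B \<and>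
     real_of_int B < sqrt (real_of_int (disc (A, B, C)))"

fun rho_r :: "bqf \<Rightarrow> int" where
  "rho_r (A, B, C) =
     (let s = sqrt (real_of_int (disc (A, B, C))) in
      if \<bar>real_of_int C\<bar> \<ge> s
      then sgn C * \<lfloor>real_of_int B / (2 * \<bar>real_of_int C\<bar>)\<rfloor>
      else sgn C * \<lfloor>(real_of_int B + s) / (2 * \<bar>real_of_int C\<bar>)\<rfloor>)"

fun rho :: "bqf \<Rightarrow> bqf" where
  "rho (A, B, C) =
     (let r = rho_r (A, B, C) in (C, - B + 2 * C * r, C * r\<^sup>2 - B * r + A))"

text \<open>Since \<open>rho\<close> permutes the reduced forms of a given discriminant, iterating it beyond a
  reduced form may reach further reduced forms; the reduction of \<open>F\<close> is the first one.
  \<open>is_reduction F j G\<close> says that \<open>G\<close> is the reduction of \<open>F\<close> and is reached at step \<open>j\<close>.\<close>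
definition is_reduction :: "bqf \<Rightarrow> nat \<Rightarrow> bqf \<Rightarrow> bool" where
  "is_reduction F j G \<longleftrightarrow>
     (rho ^^ j) F = G \<and> reduced G \<and> (\<forall>i<j. \<not> reduced ((rho ^^ i) F))"

definition norm_form :: "int \<Rightarrow> bqf" where
  "norm_form d = (1, 0, - d)"

text \<open>For \<open>d = a\<^sup>2\<^sup>k b\<^sup>2\<^sup>l - 2 c\<^sup>m\<close> the expected second iterate \<open>(1, 2hc\<^sup>m - 2, 1 - 2(h - 1)c\<^sup>m)\<close>
  presupposes \<open>h \<noteq> 1\<close>, where \<open>h = a\<^sup>k b\<^sup>l / c\<^sup>m\<close>.  Square-freeness of that \<open>d\<close> alone does not
  exclude \<open>h = 1\<close>: the values \<open>a = c = 3\<close>, \<open>b = k = l = m = 1\<close> give \<open>d = 3\<close>, and the form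
  \<open>(1, 4, 1)\<close> is not the second iterate, nor is it reduced.\<close>
lemma norm_form_3:
  shows "(rho ^^ 2) (norm_form 3) = (1, 2, -2)" and "\<not> reduced (1, 4, 1)"
proof -
  have s12: "sqrt 12 = 2 * sqrt 3"
    using real_sqrt_mult[of 4 3] by simp
  have lo: "1 < sqrt 3" and hi: "sqrt 3 < 2"
    by (auto intro: real_less_rsqrt real_less_lsqrt)
  have "sqrt 12 < 4"
    using s12 hi by simp
  moreover have "\<lfloor>sqrt 3\<rfloor> = 1" "\<lfloor>sqrt 3 / 3\<rfloor> = 0"
    using lo hi by (auto simp: floor_eq_iff)
  moreover have "\<not> 2 * sqrt 3 \<le> 1"
    using lo by linarith
  ultimately show "(rho ^^ 2) (norm_form 3) = (1, 2, -2)" and "\<not> reduced (1, 4, 1)"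
    by (auto simp: norm_form_def numeral_2_eq_2 Let_def s12)
qed

text \<open>If all of \<open>a\<^sup>2\<^sup>k b\<^sup>2\<^sup>l \<plusminus> i c\<^sup>m\<close> for \<open>i = 1, 2\<close> are square-free, then \<open>h \<noteq> 1\<close> is automatic.\<close>
lemma h_neq_1:
  fixes a b c :: int
  assumes "squarefree (a ^ (2 * k) * b ^ (2 * l) + c ^ m)"
    and "squarefree (a ^ (2 * k) * b ^ (2 * l) + 2 * c ^ m)"
    and "squarefree (a ^ (2 * k) * b ^ (2 * l) - c ^ m)"
  shows "a ^ k * b ^ l \<noteq> c ^ m"
proof
  assume eq: "a ^ k * b ^ l = c ^ m"
  define N where "N = c ^ m"
  have sq: "a ^ (2 * k) * b ^ (2 * l) = N\<^sup>2"
    unfolding N_def eq[symmetric] by (simp add: power_mult_distrib mult.commute flip: power_mult)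
  have no4: "\<not> 4 dvd x" if "squarefree x" for x :: int
  proof
    assume "4 dvd x"
    hence "2\<^sup>2 dvd x" by simp
    with that have "(2::int) dvd 1" unfolding squarefree_def by blast
    thus False by simp
  qed
  have "\<not> 4 dvd N\<^sup>2 + N" "\<not> 4 dvd N\<^sup>2 + 2 * N" "\<not> 4 dvd N\<^sup>2 - N"
    using assms no4 unfolding sq N_def[symmetric] by auto
  hence no: "\<not> 4 dvd N * (N + 1)" "\<not> 4 dvd N * (N + 2)" "\<not> 4 dvd N * (N - 1)"
    by (simp_all add: power2_eq_square algebra_simps)
  show False
  proof (cases "even N")
    case True
    hence "2 * 2 dvd N * (N + 2)" by (intro mult_dvd_mono) auto
    with no show False by simp
  next
    case False
    hence "4 dvd N + 1 \<or> 4 dvd N - 1" by presburger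
    with no show False by (auto intro: dvd_mult)
  qed
qed

end

theory Submission
  imports Defs
begin

text \<open>Let \<open>\<Delta>\<close> be the discriminant of \<open>(A, B, C)\<close>.  If \<open>0 < 2 |C| \<le> \<surd>\<Delta>\<close>, the floor in the
  reduction step puts the new middle coefficient into \<open>(\<surd>\<Delta> - 2 |C|, \<surd>\<Delta>]\<close>, and the step yields a
  reduced form unless the right end point is attained.  From \<open>(1, 0, -d)\<close> the first step merely
  swaps the outer coefficients, so \<open>C = 1\<close> in the second step, which reaches the reduced form
  \<open>(1, 2\<lfloor>\<surd>d\<rfloor>, \<lfloor>\<surd>d\<rfloor>\<^sup>2 - d)\<close>.  Let \<open>N = a\<^sup>k b\<^sup>l = h c\<^sup>m\<close>.  The positive number
  \<open>d = N\<^sup>2 \<plusminus> i c\<^sup>m\<close>, with \<open>i \<le> 2h\<close> for the plus sign and \<open>i \<le> h\<close> for the minus sign, lies strictly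
  between consecutive squares: \<open>\<lfloor>\<surd>d\<rfloor>\<close> is \<open>N\<close> and \<open>N - 1\<close>, respectively.\<close>

lemma disc_rho: "disc (rho F) = disc F"
  by (cases F) (simp add: Let_def power2_eq_square algebra_simps del: rho_r.simps)

lemma reduced_imp_middle_pos:
  assumes "reduced (A, B, C)"
  shows "0 < B"
proof -
  have "0 < real_of_int B"
    using assms by (auto intro: le_less_trans[OF abs_ge_zero])
  then show ?thesis
    by simp
qed

lemma rho_diagonal:
  assumes "\<bar>A\<bar> < \<bar>C\<bar>"
  shows "rho (A, 0, C) = (C, 0, A)"
proof -
  define s where "s = sqrt (disc (A, 0, C))"
  have "- (A * C) \<le> \<bar>A\<bar> * \<bar>C\<bar>"
    by (metis abs_ge_minus_self abs_mult)
  also have "\<dots> < \<bar>C\<bar> * \<bar>C\<bar>"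
    using assms by (intro mult_strict_right_mono) auto
  finally have "disc (A, 0, C) < (2 * \<bar>C\<bar>)\<^sup>2"
    by (simp add: power2_eq_square)
  then have "s < sqrt ((2 * \<bar>C\<bar>)\<^sup>2)"
    unfolding s_def by (simp only: real_sqrt_less_iff of_int_less_iff)
  then have s_less: "s < 2 * \<bar>C\<bar>"
    by (simp add: real_sqrt_mult)
  have "rho_r (A, 0, C) = 0"
  proof (cases "s \<le> \<bar>C\<bar>")
    case True
    then show ?thesis
      by (simp add: Let_def s_def)
  next
    case False
    then have "0 \<le> s"
      by linarith
    with s_less have "\<lfloor>s / (2 * \<bar>C\<bar>)\<rfloor> = 0"
      by (simp add: floor_eq_iff divide_less_eq)
    with False show ?thesis
      by (simp add: Let_def s_def)
  qed
  then show ?thesis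
    by (simp add: Let_def)
qed

lemma reduced_rho:
  fixes A B C :: int and s :: real
  defines "s \<equiv> sqrt (disc (A, B, C))"
  assumes C_nonzero: "C \<noteq> 0" and C_le: "2 * \<bar>C\<bar> \<le> s"
    and non_integral: "(B + s) / (2 * \<bar>C\<bar>) \<notin> \<int>"
  shows "reduced (rho (A, B, C))"
proof -
  define q where "q = (B + s) / (2 * \<bar>C\<bar>)"
  define B' where "B' = 2 * \<bar>C\<bar> * \<lfloor>q\<rfloor> - B"
  have "\<not> s \<le> \<bar>C\<bar>"
    using C_nonzero C_le by linarith
  then have "rho_r (A, B, C) = sgn C * \<lfloor>q\<rfloor>"
    by (simp add: q_def s_def)
  then obtain C' where rho: "rho (A, B, C) = (C, B', C')"
    by (simp add: B'_def abs_sgn Let_def mult.assoc mult.left_commute del: rho_r.simps)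
  have "real_of_int \<lfloor>q\<rfloor> \<noteq> q"
    using non_integral unfolding q_def by (metis Ints_of_int)
  then have "q - 1 < \<lfloor>q\<rfloor>" and "\<lfloor>q\<rfloor> < q"
    using of_int_floor_le[of q] by linarith+
  then have "2 * \<bar>C\<bar> * (q - 1) < 2 * \<bar>C\<bar> * \<lfloor>q\<rfloor>" and "2 * \<bar>C\<bar> * \<lfloor>q\<rfloor> < 2 * \<bar>C\<bar> * q"
    using C_nonzero by auto
  moreover have "2 * \<bar>C\<bar> * q = B + s"
    using C_nonzero by (simp add: q_def)
  ultimately have "s - 2 * \<bar>C\<bar> < B'" and "B' < s"
    by (simp_all add: B'_def right_diff_distrib)
  moreover have "0 < s"
    using C_nonzero C_le by linarith
  then have "0 < disc (A, B, C)"
    by (simp add: s_def del: disc.simps)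
  moreover have "disc (C, B', C') = disc (A, B, C)"
    using disc_rho[of "(A, B, C)"] rho by simp
  ultimately show ?thesis
    using C_le unfolding rho reduced.simps s_def by simp
qed

theorem is_reduction_norm_form:
  fixes d :: int
  assumes "0 < d" and "sqrt d \<notin> \<int>"
  shows "is_reduction (norm_form d) 2 (1, 2 * \<lfloor>sqrt d\<rfloor>, \<lfloor>sqrt d\<rfloor>\<^sup>2 - d)"
proof -
  have sqrt_disc: "sqrt (4 * real_of_int d) = 2 * sqrt d"
    by (simp add: real_sqrt_mult)
  have sqrt_ge_1: "1 \<le> sqrt d"
    using assms(1) by simp
  have "d \<noteq> 1"
    using assms(2) by auto
  then have first_step: "rho (norm_form d) = (- d, 0, 1)"
    using assms(1) by (simp add: norm_form_def rho_diagonal del: rho.simps)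
  have "\<not> 2 * sqrt d \<le> 1"
    using sqrt_ge_1 by linarith
  then have second_step: "rho (- d, 0, 1) = (1, 2 * \<lfloor>sqrt d\<rfloor>, \<lfloor>sqrt d\<rfloor>\<^sup>2 - d)"
    by (simp add: sqrt_disc Let_def)
  have "reduced (rho (- d, 0, 1))"
    using assms(2) sqrt_ge_1 by (intro reduced_rho) (simp_all add: sqrt_disc)
  moreover have "\<not> reduced (norm_form d)" "\<not> reduced (- d, 0, 1)"
    unfolding norm_form_def by (blast dest: reduced_imp_middle_pos)+
  ultimately show ?thesis
    using first_step second_step by (auto simp: is_reduction_def numeral_2_eq_2 less_Suc_eq)
qed

lemma is_reduction_norm_form_square_plus:
  fixes n e :: int
  assumes "0 < e" and "e \<le> 2 * n"
  shows "is_reduction (norm_form (n\<^sup>2 + e)) 2 (1, 2 * n, - e)"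
proof -
  let ?d = "n\<^sup>2 + e"
  have "real_of_int e < 2 * real_of_int n + 1"
    using assms(2) by linarith
  then have "(real_of_int n)\<^sup>2 < ?d" and "?d < (real_of_int n + 1)\<^sup>2"
    using assms(1) by (simp_all add: power2_sum)
  then have lower: "n < sqrt ?d" and "sqrt ?d < n + 1"
    using assms by (auto intro: real_less_rsqrt real_less_lsqrt)
  then have floor: "\<lfloor>sqrt ?d\<rfloor> = n"
    by (simp add: floor_eq_iff)
  have "sqrt ?d \<notin> \<int>"
    using lower floor by (metis floor_of_int Ints_cases less_irrefl)
  moreover have "0 < ?d"
    using assms(1) by (simp add: add_nonneg_pos)
  ultimately show ?thesis
    using is_reduction_norm_form[of ?d] unfolding floor by simp
qed

lemma is_reduction_norm_form_square_minus:
  fixes n e :: int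
  assumes "0 < e" and "e < 2 * n - 1"
  shows "is_reduction (norm_form (n\<^sup>2 - e)) 2 (1, 2 * n - 2, 1 - (2 * n - e))"
proof -
  have shift: "n\<^sup>2 - e = (n - 1)\<^sup>2 + (2 * n - e - 1)"
    by (simp add: power2_diff)
  show ?thesis
    unfolding shift using is_reduction_norm_form_square_plus[of "2 * n - e - 1" "n - 1"] assms
    by (simp add: algebra_simps)
qed

lemma is_reduction_norm_form_square_plus_multiple:
  fixes h C i :: int
  assumes "0 < C" and "0 < i" and "i \<le> 2 * h"
  shows "is_reduction (norm_form ((h * C)\<^sup>2 + i * C)) 2 (1, 2 * h * C, - (i * C))"
proof -
  have "i * C \<le> 2 * h * C"
    using assms by (intro mult_right_mono) auto
  then show ?thesis
    using is_reduction_norm_form_square_plus[of "i * C" "h * C"] assms by (simp add: mult.assoc)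
qed

lemma is_reduction_norm_form_square_minus_multiple:
  fixes h C i :: int
  assumes "0 < C" and "0 < i" and "i \<le> h" and pos: "0 < (h * C)\<^sup>2 - i * C"
  shows "is_reduction (norm_form ((h * C)\<^sup>2 - i * C)) 2 (1, 2 * h * C - 2, 1 - (2 * h - i) * C)"
proof -
  have lower: "0 < i * C" and upper: "i * C \<le> h * C"
    using assms by (auto intro: mult_right_mono)
  then have "h * C \<noteq> 1"
    using pos by auto
  with lower upper have "i * C < 2 * (h * C) - 1"
    by linarith
  then show ?thesis
    using is_reduction_norm_form_square_minus[of "i * C" "h * C"] lower
    by (simp add: algebra_simps)
qed

lemma power_dvd_power_mult_power:
  fixes a b c :: "'a :: comm_semiring_1"
  assumes "c dvd a * b" and "m \<le> k" and "m \<le> l"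
  shows "c ^ m dvd a ^ k * b ^ l"
proof -
  have "c ^ m dvd a ^ m * b ^ m"
    using dvd_power_same[OF assms(1), of m] by (simp add: power_mult_distrib)
  also have "a ^ m * b ^ m dvd a ^ k * b ^ l"
    using assms(2,3) by (intro mult_dvd_mono le_imp_power_dvd)
  finally show ?thesis .
qed

theorem theorem5p3:
  fixes a b c h d1p d2p d1m d2m :: int and k l m :: nat
  assumes "a > 0" and "b > 0" and "c > 0" and "k > 0" and "l > 0" and "m > 0"
    and "c dvd a * b" and "k \<ge> m" and "l \<ge> m"
    and "h = (a ^ k * b ^ l) div (c ^ m)"
    and "d1p = a ^ (2 * k) * b ^ (2 * l) + c ^ m"
    and "d2p = a ^ (2 * k) * b ^ (2 * l) + 2 * c ^ m"
    and "d1m = a ^ (2 * k) * b ^ (2 * l) - c ^ m"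
    and "d2m = a ^ (2 * k) * b ^ (2 * l) - 2 * c ^ m"
  shows "c ^ m dvd a ^ k * b ^ l \<and> h > 0 \<and>
    (d1p > 0 \<and> squarefree d1p \<longrightarrow>
       is_reduction (norm_form d1p) 2 (1, 2 * h * c ^ m, - (c ^ m))) \<and>
    (d2p > 0 \<and> squarefree d2p \<longrightarrow>
       is_reduction (norm_form d2p) 2 (1, 2 * h * c ^ m, - (2 * c ^ m))) \<and>
    (d1m > 0 \<and> squarefree d1m \<longrightarrow>
       is_reduction (norm_form d1m) 2 (1, 2 * h * c ^ m - 2, 1 - (2 * h - 1) * c ^ m)) \<and>
    (d2m > 0 \<and> squarefree d2m \<and> h \<noteq> 1 \<longrightarrow>
       is_reduction (norm_form d2m) 2 (1, 2 * h * c ^ m - 2, 1 - 2 * (h - 1) * c ^ m))"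
proof -
  define N C where "N = a ^ k * b ^ l" and "C = c ^ m"
  have dvd: "C dvd N"
    unfolding N_def C_def using assms by (intro power_dvd_power_mult_power)
  have pos: "0 < N" "0 < C"
    using assms by (simp_all add: N_def C_def)
  have N_eq: "N = h * C"
    using dvd assms(10) by (simp add: N_def C_def)
  have h_pos: "0 < h"
    using pos N_eq by (simp add: zero_less_mult_iff)
  have square: "a ^ (2 * k) * b ^ (2 * l) = (h * C)\<^sup>2"
    unfolding N_eq[symmetric] N_def
    by (simp add: power_mult_distrib mult.commute flip: power_mult)
  note reductions =
    is_reduction_norm_form_square_plus_multiple[of C 1 h]
    is_reduction_norm_form_square_plus_multiple[of C 2 h]
    is_reduction_norm_form_square_minus_multiple[of C 1 h]
    is_reduction_norm_form_square_minus_multiple[of C 2 h]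
  have "2 * h - 2 = 2 * (h - 1)"
    by simp
  then show ?thesis
    using dvd h_pos pos reductions
    unfolding assms(11-14) square N_def[symmetric] C_def[symmetric] by simp
qed

end
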